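(* Let $G$ be a finite non-abelian group of order $pq$, where $p$ and $q$ are distinct primes and $p<q$. Then $|c(G)|=q+2$.
   Context: For a finite group $G$, $c(G)$ denotes the set of all cyclic subgroups of $G$ (including the trivial subgroup), so $|c(G)|$ is the number of cyclic subgroups of $G$. *)

theory Defs
  imports "HOL-Algebra.Algebra"
begin

definition cyclic_subgroups :: "('a, 'b) monoid_scheme \<Rightarrow> 'a set set" where
  "cyclic_subgroups G = {H. subgroup H G \<and> cyclic_group (G\<lparr>carrier := H\<rparr>)}"

end

(* A group of order pq that is not cyclic is, apart from the identity, the disjoint union of
   the sets H - {1} for its subgroups H of prime order.  Two distinct subgroups of order q would
   have a product set of q^2 > pq elements, so there is exactly one.  Counting the
   remaining q(p - 1) elements leaves q subgroups of order p; the trivial subgroup completes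
   the list of cyclic subgroups. *)

theory Submission
  imports Defs
begin

context group
begin

text \<open>By Lagrange the order of \<open>x\<close> divides the prime \<open>card H\<close>, and
  it is not 1 because \<open>x\<close> is not the identity.\<close>

lemma generate_prime_order_subgroup:
  assumes H: "subgroup H G" and prime: "Factorial_Ring.prime (card H)"
    and x: "x \<in> H" "x \<noteq> \<one>"
  shows "generate G {x} = H"
proof -
  \<comment> \<open>\<open>card\<close> of an infinite set is 0, so primality forces finiteness even
    when \<open>G\<close> is infinite.\<close>
  have fin: "finite H"
    using prime by (metis card.infinite not_prime_0)
  have le: "generate G {x} \<subseteq> H"
    using generate_subgroup_incl[OF _ H] x by simp
  have xG: "x \<in> carrier G"
    using H x by (meson subgroup.mem_carrier)
  interpret H: group "G\<lparr>carrier := H\<rparr>"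
    using H by (rule subgroup_imp_group)
  \<comment> \<open>Lagrange is to be applied with \<open>H\<close> as the ambient group, so the
    closure of \<open>x\<close> in \<open>G\<close> is first identified with its closure in
    \<open>H\<close>.\<close>
  have "subgroup (generate G {x}) (G\<lparr>carrier := H\<rparr>)"
    using H.generate_is_subgroup[of "{x}"] generate_consistent[OF _ H, of "{x}"] x by simp
  from H.lagrange[OF this] have
    "card (rcosets\<^bsub>G\<lparr>carrier := H\<rparr>\<^esub> generate G {x}) * card (generate G {x}) = card H"
    by (simp add: order_def)
  then have "card (generate G {x}) dvd card H"
    by (metis dvd_triv_right)
  moreover have "card (generate G {x}) \<noteq> 1"
    using generate_pow_card[OF xG] ord_eq_1[OF xG] x by simp
  ultimately have "card (generate G {x}) = card H"
    using prime by (auto simp: prime_nat_iff)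
  with le fin show ?thesis
    by (simp add: card_subset_eq)
qed

text \<open>A common element other than the identity would generate both subgroups. The two primes
  may differ, so subgroups of order \<open>p\<close> and of order \<open>q\<close> are handled
  together.\<close>

lemma Int_prime_order_subgroups:
  assumes "subgroup H G" "Factorial_Ring.prime (card H)"
    and "subgroup K G" "Factorial_Ring.prime (card K)" and "H \<noteq> K"
  shows "H \<inter> K = {\<one>}"
  using assms generate_prime_order_subgroup[of H] generate_prime_order_subgroup[of K]
    subgroup.one_closed[of H G] subgroup.one_closed[of K G]
  by blast

text \<open>Multiplication embeds \<open>H \<times> K\<close> into \<open>G\<close>: two
  factorisations of one element differ by an element lying in both \<open>H\<close> and
  \<open>K\<close>, hence by the identity.\<close>

lemma card_mult_subgroups_le_order:
  assumes fin: "finite (carrier G)" and H: "subgroup H G" and K: "subgroup K G"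
    and HK: "H \<inter> K = {\<one>}"
  shows "card H * card K \<le> order G"
proof -
  have sub: "H \<subseteq> carrier G" "K \<subseteq> carrier G"
    using H K by (auto dest: subgroup.subset)
  have "inj_on (\<lambda>(h, k). h \<otimes> k) (H \<times> K)"
  proof (rule inj_onI, clarsimp)
    fix h k h' k' assume *: "h \<in> H" "k \<in> K" "h' \<in> H" "k' \<in> K" "h \<otimes> k = h' \<otimes> k'"
    then have G: "h \<in> carrier G" "k \<in> carrier G" "h' \<in> carrier G" "k' \<in> carrier G"
      using sub by auto
    have eq: "inv h' \<otimes> h = k' \<otimes> inv k"
    proof -
      have "h = h' \<otimes> k' \<otimes> inv k"
        using G *(5) by (subst inv_solve_right) auto
      then have "h = h' \<otimes> (k' \<otimes> inv k)"
        using G by (simp add: m_assoc)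
      then show ?thesis
        using G by (subst inv_solve_left') auto
    qed
    have "inv h' \<otimes> h \<in> H" "k' \<otimes> inv k \<in> K"
      using * H K by (simp_all add: subgroup.m_closed subgroup.m_inv_closed)
    then have "inv h' \<otimes> h = \<one>" "k' \<otimes> inv k = \<one>"
      using HK eq by auto
    then show "h = h' \<and> k = k'"
      using G inv_solve_left'[of "\<one>" h' h] inv_solve_right'[of "\<one>" k' k] by simp
  qed
  moreover have "(\<lambda>(h, k). h \<otimes> k) ` (H \<times> K) \<subseteq> carrier G"
    using sub by auto
  ultimately have "card (H \<times> K) \<le> card (carrier G)"
    using fin card_inj_on_le by blast
  then show ?thesis
    by (simp add: card_cartesian_product order_def)
qed

text \<open>This turns cyclicity, defined internally to each subgroup, into generation by one
  element of \<open>G\<close>, so that classifying the sets \<open>generate G {x}\<close>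
  suffices.\<close>

lemma cyclic_subgroups_eq_generate: "cyclic_subgroups G = (\<lambda>x. generate G {x}) ` carrier G"
proof (intro equalityI subsetI)
  fix H assume "H \<in> cyclic_subgroups G"
  then have H: "subgroup H G" and "cyclic_group (G\<lparr>carrier := H\<rparr>)"
    by (auto simp: cyclic_subgroups_def)
  then obtain x where x: "x \<in> H" "subgroup_generated (G\<lparr>carrier := H\<rparr>) {x} = G\<lparr>carrier := H\<rparr>"
    by (auto simp: cyclic_group_def)
  have "carrier (subgroup_generated (G\<lparr>carrier := H\<rparr>) {x}) = generate G {x}"
    using generate_consistent[OF _ H, of "{x}"] x(1) by (simp add: carrier_subgroup_generated)
  with x(2) have "H = generate G {x}"
    by simp
  then show "H \<in> (\<lambda>x. generate G {x}) ` carrier G"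
    using H x(1) by (auto dest: subgroup.mem_carrier)
next
  fix H assume "H \<in> (\<lambda>x. generate G {x}) ` carrier G"
  then obtain x where x: "x \<in> carrier G" "H = generate G {x}"
    by auto
  then have "subgroup_generated G {x} = G\<lparr>carrier := H\<rparr>"
    by (simp add: subgroup_generated_def)
  then show "H \<in> cyclic_subgroups G"
    using x generate_is_subgroup[of "{x}"] cyclic_group_generated[of x]
    by (simp add: cyclic_subgroups_def)
qed

end

theorem lemma3p1:
  fixes G :: "('a, 'b) monoid_scheme" and p q :: nat
  assumes "group G" and "finite (carrier G)" and "\<not> comm_group G"
    and "Factorial_Ring.prime p" and "Factorial_Ring.prime q" and "p < q"
    and "order G = p * q"
  shows "card (cyclic_subgroups G) = q + 2"
proof -
  interpret group G by fact
  note fin = assms(2) and p = assms(4) and q = assms(5) and ord = assms(7)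
  define S where "S d = {H. subgroup H G \<and> card H = d}" for d
  have finS: "finite (S d)" for d
    by (rule finite_subset[of _ "Pow (carrier G)"])
       (use fin in \<open>auto simp: S_def dest: subgroup.subset\<close>)
  have disj: "H \<inter> K = {\<one>\<^bsub>G\<^esub>}" if "H \<in> S p \<union> S q" "K \<in> S p \<union> S q" "H \<noteq> K" for H K
    using that p q by (intro Int_prime_order_subgroups) (auto simp: S_def)

  have gen: "generate G {x} \<in> S p \<union> S q" if x: "x \<in> carrier G" "x \<noteq> \<one>\<^bsub>G\<^esub>" for x
  proof -
    let ?d = "card (generate G {x})"
    have sub: "subgroup (generate G {x}) G"
      using x generate_is_subgroup by simp
    have "?d dvd p * q"
      using ord_dvd_group_order[OF x(1)] generate_pow_card[OF x(1)] ord by simp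
    \<comment> \<open>A divisor of a product is a product of divisors of the factors; primality then
      leaves four candidates for the order of \<open>x\<close>.\<close>
    then obtain b c where bc: "?d = b * c" "b dvd p" "c dvd q"
      using division_decomp by blast
    have "b = 1 \<or> b = p" "c = 1 \<or> c = q"
      using bc p q by (auto simp only: prime_nat_iff)
    then have "b * c = 1 \<or> b * c = p \<or> b * c = q \<or> b * c = p * q"
      by (elim disjE) simp_all
    then have d: "?d = 1 \<or> ?d = p \<or> ?d = q \<or> ?d = p * q"
      unfolding bc(1) .
    have "?d \<noteq> 1"
      using generate_pow_card[OF x(1)] ord_eq_1[OF x(1)] x by simp
    \<comment> \<open>An element of order \<open>p * q\<close> would make \<open>G\<close> cyclic,
      hence abelian.\<close>
    moreover have "?d \<noteq> p * q"
    proof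
      assume "?d = p * q"
      then have "generate G {x} = carrier G"
        using fin ord subgroup.subset[OF sub] by (simp add: card_subset_eq order_def)
      then have "subgroup_generated G {x} = G"
        using x by (simp add: subgroup_generated_def)
      then have "comm_group G"
        using cyclic_group_generated[of x] cyclic_imp_abelian_group by simp
      with assms(3) show False ..
    qed
    ultimately have "?d = p \<or> ?d = q"
      using d by blast
    with sub show ?thesis
      unfolding S_def by blast
  qed

  \<comment> \<open>Sylow with exponent 1 and cofactor \<open>p\<close> gives existence; uniqueness
    follows from the product bound.\<close>
  obtain Q where Q: "Q \<in> S q"
    using sylow_thm[of q G 1 p] q ord fin is_group by (auto simp: S_def mult.commute)
  have "H = Q" if "H \<in> S q" for H
  proof (rule ccontr)
    assume "H \<noteq> Q"
    with that Q have "card H * card Q \<le> order G"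
      by (intro card_mult_subgroups_le_order fin disj) (auto simp: S_def)
    then have "q * q \<le> p * q"
      using that Q ord by (simp add: S_def)
    with \<open>p < q\<close> show False
      by simp
  qed
  with Q have Sq: "S q = {Q}"
    by blast

  have pq: "S p \<inter> S q = {}"
    using \<open>p < q\<close> by (auto simp: S_def)
  \<comment> \<open>Each non-identity element lies in the subgroup it generates; by
    \<open>disj\<close> these punctured subgroups do not overlap, so their sizes add up.\<close>
  have "carrier G - {\<one>\<^bsub>G\<^esub>} = (\<Union>H \<in> S p \<union> S q. H - {\<one>\<^bsub>G\<^esub>})"
  proof (intro equalityI subsetI)
    fix x assume "x \<in> carrier G - {\<one>\<^bsub>G\<^esub>}"
    then show "x \<in> (\<Union>H \<in> S p \<union> S q. H - {\<one>\<^bsub>G\<^esub>})"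
      using gen[of x] generate.incl[of x "{x}" G] by blast
  qed (auto simp: S_def dest: subgroup.mem_carrier)
  then have "card (carrier G - {\<one>\<^bsub>G\<^esub>}) = card (\<Union>H \<in> S p \<union> S q. H - {\<one>\<^bsub>G\<^esub>})"
    by simp
  also have "\<dots> = (\<Sum>H \<in> S p \<union> S q. card (H - {\<one>\<^bsub>G\<^esub>}))"
  proof (rule card_UN_disjoint)
    show "\<forall>H \<in> S p \<union> S q. finite (H - {\<one>\<^bsub>G\<^esub>})"
      using fin by (auto simp: S_def dest!: subgroup.subset dest: finite_subset)
    show "\<forall>H \<in> S p \<union> S q. \<forall>K \<in> S p \<union> S q.
      H \<noteq> K \<longrightarrow> (H - {\<one>\<^bsub>G\<^esub>}) \<inter> (K - {\<one>\<^bsub>G\<^esub>}) = {}"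
      using disj by blast
  qed (simp add: finS)
  also have "\<dots> = (\<Sum>H \<in> S p \<union> S q. card H - 1)"
    by (rule sum.cong) (auto simp: S_def card_Diff_singleton subgroup.one_closed)
  also have "\<dots> = (\<Sum>H \<in> S p. card H - 1) + (\<Sum>H \<in> S q. card H - 1)"
    using pq by (rule sum.union_disjoint[OF finS finS])
  also have "(\<Sum>H \<in> S p. card H - 1) = card (S p) * (p - 1)"
    by (simp add: S_def)
  also have "(\<Sum>H \<in> S q. card H - 1) = q - 1"
    unfolding Sq using Q by (simp add: S_def)
  finally have count: "p * q - 1 = card (S p) * (p - 1) + (q - 1)"
    using ord by (simp add: order_def card_Diff_singleton)
  \<comment> \<open>Positivity of \<open>p\<close> and \<open>q\<close> keeps the truncated
    subtractions exact; the term \<open>q - 1\<close> for \<open>Q\<close> then cancels.\<close>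
  have "p * q = q * (p - 1) + q"
    using prime_gt_0_nat[OF p] by (simp add: algebra_simps)
  with count have "card (S p) * (p - 1) = q * (p - 1)"
    using prime_gt_0_nat[OF q] by linarith
  then have Sp: "card (S p) = q"
    using prime_gt_1_nat[OF p] by simp

  \<comment> \<open>The cyclic subgroups are now listed by two inclusions: every element generates a
    listed subgroup, and every listed subgroup has a generator.\<close>
  have "generate G {x} \<in> insert {\<one>\<^bsub>G\<^esub>} (S p \<union> S q)" if "x \<in> carrier G" for x
    using gen[OF that] generate_one by (cases "x = \<one>\<^bsub>G\<^esub>") auto
  moreover have "H \<in> (\<lambda>x. generate G {x}) ` carrier G" if "H \<in> S p \<union> S q" for H
  proof -
    from that have H: "subgroup H G" "Factorial_Ring.prime (card H)"
      using p q by (auto simp: S_def)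
    then have "\<not> H \<subseteq> {\<one>\<^bsub>G\<^esub>}"
      using prime_gt_1_nat[OF H(2)] card_mono[of "{\<one>\<^bsub>G\<^esub>}" H] by auto
    then obtain x where "x \<in> H" "x \<noteq> \<one>\<^bsub>G\<^esub>"
      by blast
    with H show ?thesis
      using generate_prime_order_subgroup[OF H] by (auto dest: subgroup.mem_carrier)
  qed
  moreover have "{\<one>\<^bsub>G\<^esub>} \<in> (\<lambda>x. generate G {x}) ` carrier G"
    using generate_one by force
  ultimately have "cyclic_subgroups G = insert {\<one>\<^bsub>G\<^esub>} (S p \<union> S q)"
    unfolding cyclic_subgroups_eq_generate by blast
  \<comment> \<open>Since 1 is not prime, the trivial subgroup is counted separately: the total is 1
    for it, \<open>q\<close> from \<open>S p\<close> and 1 for \<open>Q\<close>.\<close>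
  moreover have "{\<one>\<^bsub>G\<^esub>} \<notin> S p \<union> S q"
    using p q by (auto simp: S_def)
  ultimately show ?thesis
    using finS pq Sp by (simp add: card_Un_disjoint Sq)
qed

end
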